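(* For every $n\ge1$, the homology of the ordered partition poset $\Pi_O(n)$ with coefficients in $k$ is the $\mathbb{S}_n$-module $$H_l(\Pi_O(n))\cong\begin{cases}k[\mathbb{S}_n]&\text{if } l=n-1,\\0&\text{otherwise.}\end{cases}$$
   Context: $k$ denotes $\mathbb{Z}$, $\mathbb{Q}$, $\mathbb{F}_p$ or a field of characteristic $0$. An ordered partition of $[n]$ is a set of linearly ordered sequences of elements of $[n]$ giving a set partition of $[n]$ after forgetting the orders. In $\Pi_O(n)$, $\lambda\le\mu$ iff each block of $\lambda$ is the concatenation of an ordered sequence of blocks of $\mu$; minimal elements are $\{(\tau(1),\dots,\tau(n))\}$, $\tau\in\mathbb{S}_n$, maximal element $\{(1),\dots,(n)\}$; $\mathbb{S}_n$ acts by relabelling. $H_l(\Pi)$ is the homology of the complex spanned by chains $\lambda_0<\cdots<\lambda_l$ with $\lambda_0$ minimal and $\lambda_l$ maximal, differential $\sum_{0<i<l}(-1)^id_i$, $d_i$ omitting $\lambda_i$. $k[\mathbb{S}_n]$ is the regular representation. *)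

theory Defs
  imports "HOL-Combinatorics.Permutations" "HOL-Computational_Algebra.Primes"
begin

definition ordered_partition :: "nat \<Rightarrow> nat list set \<Rightarrow> bool" where
  "ordered_partition n P \<longleftrightarrow>
     finite P \<and>
     (\<forall>b\<in>P. b \<noteq> [] \<and> distinct b) \<and>
     (\<forall>b\<in>P. \<forall>b'\<in>P. b \<noteq> b' \<longrightarrow> set b \<inter> set b' = {}) \<and>
     (\<Union>b\<in>P. set b) = {1..n}"

definition PiO :: "nat \<Rightarrow> nat list set set" where
  "PiO n = {P. ordered_partition n P}"

definition opleq :: "nat list set \<Rightarrow> nat list set \<Rightarrow> bool" where
  "opleq L M \<longleftrightarrow> (\<forall>b\<in>L. \<exists>bs. set bs \<subseteq> M \<and> b = concat bs)"

definition opless :: "nat list set \<Rightarrow> nat list set \<Rightarrow> bool" where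
  "opless L M \<longleftrightarrow> opleq L M \<and> L \<noteq> M"

definition op_minimal :: "nat \<Rightarrow> nat list set \<Rightarrow> bool" where
  "op_minimal n L \<longleftrightarrow> L \<in> PiO n \<and> (\<forall>M\<in>PiO n. opleq M L \<longrightarrow> M = L)"

definition op_maximal :: "nat \<Rightarrow> nat list set \<Rightarrow> bool" where
  "op_maximal n L \<longleftrightarrow> L \<in> PiO n \<and> (\<forall>M\<in>PiO n. opleq L M \<longrightarrow> M = L)"

definition is_chain :: "nat \<Rightarrow> nat \<Rightarrow> nat list set list \<Rightarrow> bool" where
  "is_chain n l ch \<longleftrightarrow>
     length ch = Suc l \<and> (\<forall>L\<in>set ch. L \<in> PiO n) \<and>
     (\<forall>i<l. opless (ch ! i) (ch ! Suc i)) \<and>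
     op_minimal n (ch ! 0) \<and> op_maximal n (ch ! l)"

definition chains :: "nat \<Rightarrow> nat \<Rightarrow> nat list set list set" where
  "chains n l = {ch. is_chain n l ch}"

definition Cgroup :: "nat \<Rightarrow> nat \<Rightarrow> (nat list set list \<Rightarrow> 'k::comm_ring_1) set" where
  "Cgroup n l = {c. \<forall>ch. c ch \<noteq> 0 \<longrightarrow> ch \<in> chains n l}"

definition del_nth :: "nat \<Rightarrow> 'a list \<Rightarrow> 'a list" where
  "del_nth i xs = take i xs @ drop (Suc i) xs"

definition bdry :: "nat \<Rightarrow> nat \<Rightarrow> (nat list set list \<Rightarrow> 'k::comm_ring_1)
                      \<Rightarrow> (nat list set list \<Rightarrow> 'k)" where
  "bdry n l c = (\<lambda>ch'. if ch' \<in> chains n (l - 1) then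
      (\<Sum>ch\<in>chains n l. \<Sum>i\<in>{1..<l}.
          if del_nth i ch = ch' then (-1) ^ i * c ch else 0)
    else 0)"

definition cycles :: "nat \<Rightarrow> nat \<Rightarrow> (nat list set list \<Rightarrow> 'k::comm_ring_1) set" where
  "cycles n l = {c \<in> Cgroup n l. bdry n l c = (\<lambda>_. 0)}"

definition boundaries :: "nat \<Rightarrow> nat \<Rightarrow> (nat list set list \<Rightarrow> 'k::comm_ring_1) set" where
  "boundaries n l = bdry n (Suc l) ` Cgroup n (Suc l)"

definition relabel :: "(nat \<Rightarrow> nat) \<Rightarrow> nat list set \<Rightarrow> nat list set" where
  "relabel \<sigma> L = map \<sigma> ` L"

definition chain_act :: "(nat \<Rightarrow> nat) \<Rightarrow> (nat list set list \<Rightarrow> 'k) \<Rightarrow> (nat list set list \<Rightarrow> 'k)" where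
  "chain_act \<sigma> c = (\<lambda>ch. c (map (relabel (inv \<sigma>)) ch))"

definition regrep :: "nat \<Rightarrow> ((nat \<Rightarrow> nat) \<Rightarrow> 'k::comm_ring_1) set" where
  "regrep n = {f. \<forall>\<tau>. f \<tau> \<noteq> 0 \<longrightarrow> \<tau> permutes {1..n}}"

definition reg_act :: "(nat \<Rightarrow> nat) \<Rightarrow> ((nat \<Rightarrow> nat) \<Rightarrow> 'k) \<Rightarrow> ((nat \<Rightarrow> nat) \<Rightarrow> 'k)" where
  "reg_act \<sigma> f = (\<lambda>\<tau>. f (inv \<sigma> \<circ> \<tau>))"

text \<open>H_l \<cong> k[S_n] as S_n-modules, expressed as: there is a k-linear,
S_n-equivariant map from the cycles Z_l onto k[S_n] whose kernel is exactly
the boundaries B_l (first isomorphism theorem).\<close>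

definition homology_iso_regular ::
  "nat \<Rightarrow> nat \<Rightarrow> ((nat list set list \<Rightarrow> 'k::comm_ring_1) \<Rightarrow> ((nat \<Rightarrow> nat) \<Rightarrow> 'k)) \<Rightarrow> bool" where
  "homology_iso_regular n l \<phi> \<longleftrightarrow>
     (\<forall>c\<in>cycles n l. \<forall>c'\<in>cycles n l. \<phi> (\<lambda>ch. c ch + c' ch) = (\<lambda>\<tau>. \<phi> c \<tau> + \<phi> c' \<tau>)) \<and>
     (\<forall>a. \<forall>c\<in>cycles n l. \<phi> (\<lambda>ch. a * c ch) = (\<lambda>\<tau>. a * \<phi> c \<tau>)) \<and>
     (\<forall>\<sigma>. \<sigma> permutes {1..n} \<longrightarrow> (\<forall>c\<in>cycles n l. \<phi> (chain_act \<sigma> c) = reg_act \<sigma> (\<phi> c))) \<and>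
     \<phi> ` cycles n l = regrep n \<and>
     {c \<in> cycles n l. \<phi> c = (\<lambda>_. 0)} = boundaries n l"

text \<open>k is Z, Q, F_p or a field of characteristic 0 (Q is a field of char 0).\<close>

definition admissible_coeffs :: "'k::comm_ring_1 itself \<Rightarrow> bool" where
  "admissible_coeffs _ \<longleftrightarrow>
     bij (of_int :: int \<Rightarrow> 'k) \<or>
     ((0::'k) \<noteq> 1 \<and> (\<forall>x::'k. x \<noteq> 0 \<longrightarrow> (\<exists>y. x * y = 1)) \<and>
      (CHAR('k) = 0 \<or> (prime CHAR('k) \<and> finite (UNIV::'k set) \<and> card (UNIV::'k set) = CHAR('k))))"

end

(* A minimal element is a single word w. An ordered partition L above it is obtained by cutting
   w, hence is determined by the set of first letters of its blocks, a subset of [n] containing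
   hd w. So the chains starting at w are the flags of sets from {hd w} to [n], and the complex
   splits over the n! words into copies of the complex of flags in a Boolean lattice of rank n - 1.
   Choosing a letter x outside the initial set S, the complex of flags from S to [n] is chain
   homotopy equivalent to the complex of flags from insert x S to [n], shifted by one; by induction
   its homology is k, in the top degree, and a top cycle is determined by its coefficient on the
   flag that adds the letters of w from left to right. These coefficients give the isomorphism
   with the regular representation. *)

theory Submission
  imports Defs
begin

text \<open>Chains are coefficient functions, so each operator on them is a recursion on the list of
  sets where a function is evaluated, and each identity is an induction on that list. The obstacle
  to removing one letter x is that x may join a flag late, or in the same step as other letters. Let
  r restrict a function to the flags whose first step adds x alone. The identity that overcomes the
  obstacle is id = bd h + h bd + cone r with h = \<open>homotopy\<close>: the matching behind h
  deals with the flags where x has company, while \<open>cone\<close> carries a lone x back to the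
  front, with one sign for each set passed. Since \<open>bd\<close> anticommutes with both
  \<open>cone\<close> and r, exactness and the top class are transported from
  \<open>insert x S\<close> to \<open>S\<close>. The choice of x is not compatible with relabelling,
  but it only serves to prove existence and uniqueness of chains. The isomorphism itself is
  evaluation at a flag read off from the word, and is therefore equivariant without a sign.\<close>

section \<open>Flags of sets\<close>

text \<open>The initial set \<open>S\<close> of a flag is not an entry of the list.\<close>

primrec flag :: "'a set \<Rightarrow> 'a set \<Rightarrow> 'a set list \<Rightarrow> bool" where
  "flag S M [] \<longleftrightarrow> S = M"
| "flag S M (T # ts) \<longleftrightarrow> S \<subset> T \<and> flag T M ts"

text \<open>The differential, read as a coefficient formula: the coefficient at a flag collects those
  of all its one-step refinements, with the sign \<open>(-1)^i\<close> for a set inserted at index \<open>i\<close>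
  (the initial set having index 0).\<close>

primrec bd :: "'a set \<Rightarrow> ('a set list \<Rightarrow> 'k::comm_ring_1) \<Rightarrow> 'a set list \<Rightarrow> 'k" where
  "bd S c [] = 0"
| "bd S c (T # ts) = - (\<Sum>U\<in>{S<..<T}. c (U # T # ts)) - bd T (\<lambda>us. c (T # us)) ts"

text \<open>If \<open>x\<close> enters a flag as the only new element of one step, then moving this step to the
  front gives \<open>insert x S\<close> followed by a flag \<open>us\<close> from \<open>insert x S\<close>; the value of \<open>cone\<close> is
  then \<open>f us\<close> up to sign. It is 0 if \<open>x\<close> enters together with other elements.\<close>

primrec cone :: "'a \<Rightarrow> 'a set \<Rightarrow> ('a set list \<Rightarrow> 'k::comm_ring_1) \<Rightarrow> 'a set list \<Rightarrow> 'k" where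
  "cone x S f [] = 0"
| "cone x S f (T # ts) =
     (if T = insert x S then f ts
      else if x \<in> T then 0
      else - cone x T (\<lambda>us. f (insert x T # us)) ts)"

text \<open>Comes from the acyclic matching that splits a step adding \<open>X \<union> {x}\<close> with \<open>X\<close> nonempty
  into a step adding \<open>X\<close> followed by a step adding \<open>x\<close>; the critical flags are those adding
  \<open>x\<close> alone in the first step.\<close>

primrec homotopy :: "'a \<Rightarrow> 'a set \<Rightarrow> ('a set list \<Rightarrow> 'k::comm_ring_1) \<Rightarrow> 'a set list \<Rightarrow> 'k" where
  "homotopy x S c [] = 0"
| "homotopy x S c (T # ts) =
     (if x \<in> T then 0
      else - cone x T (\<lambda>us. c (insert x T # us)) ts - homotopy x T (\<lambda>us. c (T # us)) ts)"

section \<open>Elementary properties of flags; congruence and linearity of the operators\<close>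

lemma flag_subset: "flag S M ts \<Longrightarrow> S \<subseteq> M"
  by (induction ts arbitrary: S) auto

lemma flag_subset_mem: "flag S M ts \<Longrightarrow> T \<in> set ts \<Longrightarrow> S \<subset> T \<and> T \<subseteq> M"
  by (induction ts arbitrary: S) (auto dest: flag_subset)

text \<open>Each step strictly shrinks the complement inside \<open>M\<close>. The bound empties all
  degrees above the top one.\<close>

lemma flag_length: "flag S M ts \<Longrightarrow> finite M \<Longrightarrow> length ts \<le> card (M - S)"
proof (induction ts arbitrary: S)
  case (Cons T ts)
  have "T \<subseteq> M" using Cons.prems flag_subset[of T M ts] by simp
  then have "M - T \<subset> M - S" using Cons.prems by auto
  then have "card (M - T) < card (M - S)" using Cons.prems by (intro psubset_card_mono) auto
  then show ?case using Cons by force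
qed simp

lemma finite_between: "finite T \<Longrightarrow> finite {S<..<T::'a set}"
  by (rule finite_subset[of _ "Pow T"]) auto

text \<open>Brings iterated sums over pairs of inserted sets into the form required by
  \<open>sum.swap_restrict\<close>.\<close>

lemma greaterThanLessThan_restrict:
  fixes a :: "'a::order"
  shows "u \<in> {a<..<t} \<Longrightarrow> {a<..<u} = {v \<in> {a<..<t}. v < u}"
    and "v \<in> {a<..<t} \<Longrightarrow> {v<..<t} = {u \<in> {a<..<t}. v < u}"
  by auto

lemma insert_psubset_insert:
  "S \<subset> T \<Longrightarrow> x \<notin> T \<Longrightarrow> insert x S \<subset> insert x T"
  by (metis insert_ident insert_mono psubset_eq subsetD)

text \<open>The length restriction, here and in the next two lemmas, lets an identity known in one
  degree only, such as the cycle condition, be substituted under an operator.\<close>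

lemma bd_cong:
  assumes "\<And>us. flag S M us \<Longrightarrow> length us = Suc (length ts) \<Longrightarrow> c us = c' us"
    and "flag S M ts"
  shows "bd S c ts = bd S c' ts"
  using assms
proof (induction ts arbitrary: S c c')
  case (Cons T ts)
  have "(\<Sum>U\<in>{S<..<T}. c (U # T # ts)) = (\<Sum>U\<in>{S<..<T}. c' (U # T # ts))"
    using Cons.prems by (intro sum.cong) auto
  moreover have "bd T (\<lambda>us. c (T # us)) ts = bd T (\<lambda>us. c' (T # us)) ts"
    using Cons.prems by (intro Cons.IH) auto
  ultimately show ?case by simp
qed simp

lemma cone_cong:
  assumes "\<And>us. flag (insert x S) M us \<Longrightarrow> Suc (length us) = length ts \<Longrightarrow> f us = f' us"
    and "flag S M ts"
  shows "cone x S f ts = cone x S f' ts"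
  using assms
proof (induction ts arbitrary: S f f')
  case (Cons T ts)
  have "cone x T (\<lambda>us. f (insert x T # us)) ts = cone x T (\<lambda>us. f' (insert x T # us)) ts"
    if "x \<notin> T"
  proof (rule Cons.IH)
    have "insert x S \<subset> insert x T"
      using that Cons.prems by (intro insert_psubset_insert) simp_all
    then show "f (insert x T # us) = f' (insert x T # us)"
      if "flag (insert x T) M us" "Suc (length us) = length ts" for us
      using that Cons.prems by simp
  qed (use Cons.prems in simp)
  then show ?case using Cons.prems by auto
qed simp

lemma homotopy_cong:
  assumes "\<And>us. flag S M us \<Longrightarrow> Suc (length us) = length ts \<Longrightarrow> c us = c' us"
    and "flag S M ts"
  shows "homotopy x S c ts = homotopy x S c' ts"
  using assms
proof (induction ts arbitrary: S c c')
  case (Cons T ts)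
  have "cone x T (\<lambda>us. c (insert x T # us)) ts = cone x T (\<lambda>us. c' (insert x T # us)) ts"
    if "x \<notin> T"
  proof (rule cone_cong)
    have "S \<subset> insert x T" using Cons.prems by auto
    then show "c (insert x T # us) = c' (insert x T # us)"
      if "flag (insert x T) M us" "Suc (length us) = length ts" for us
      using that Cons.prems by simp
  qed (use Cons.prems in simp)
  moreover have "homotopy x T (\<lambda>us. c (T # us)) ts = homotopy x T (\<lambda>us. c' (T # us)) ts"
    using Cons.prems by (intro Cons.IH) auto
  ultimately show ?case by auto
qed simp

lemma bd_diff: "bd S (\<lambda>us. c us - c' us) ts = bd S c ts - bd S c' ts"
  by (induction ts arbitrary: S c c') (simp_all add: sum_subtractf)

lemma bd_scale: "bd S (\<lambda>us. a * c us) ts = a * bd S c ts"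
  by (induction ts arbitrary: S c) (simp_all add: sum_distrib_left algebra_simps)

lemma bd_zero: "bd S (\<lambda>us. 0) ts = 0"
  using bd_scale[of S 0 "\<lambda>_. 0" ts] by simp

lemma bd_minus: "bd S (\<lambda>us. - c us) ts = - bd S c ts"
  using bd_scale[of S "-1" c ts] by simp

lemma bd_sum: "bd S (\<lambda>us. \<Sum>i\<in>I. c i us) ts = (\<Sum>i\<in>I. bd S (c i) ts)"
proof (induction ts arbitrary: S c)
  case (Cons T ts)
  show ?case
    by (simp add: Cons sum.swap[of _ I] sum_subtractf sum_negf)
qed simp

lemma cone_diff: "cone x S (\<lambda>us. c us - c' us) ts = cone x S c ts - cone x S c' ts"
  by (induction ts arbitrary: S c c') simp_all

lemma cone_minus: "cone x S (\<lambda>us. - c us) ts = - cone x S c ts"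
  by (induction ts arbitrary: S c) simp_all

lemma cone_zero: "cone x S (\<lambda>us. 0) ts = 0"
  by (induction ts arbitrary: S) simp_all

lemma cone_sum: "cone x S (\<lambda>us. \<Sum>i\<in>I. c i us) ts = (\<Sum>i\<in>I. cone x S (c i) ts)"
  by (induction ts arbitrary: S c) (simp_all add: sum_negf)

lemma homotopy_diff: "homotopy x S (\<lambda>us. c us - c' us) ts = homotopy x S c ts - homotopy x S c' ts"
  by (induction ts arbitrary: S c c') (simp_all add: cone_diff)

lemma homotopy_minus: "homotopy x S (\<lambda>us. - c us) ts = - homotopy x S c ts"
  by (induction ts arbitrary: S c) (simp_all add: cone_minus)

lemma homotopy_zero: "homotopy x S (\<lambda>us. 0) ts = 0"
  by (induction ts arbitrary: S) (simp_all add: cone_zero)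

lemma homotopy_sum: "homotopy x S (\<lambda>us. \<Sum>i\<in>I. c i us) ts = (\<Sum>i\<in>I. homotopy x S (c i) ts)"
  by (induction ts arbitrary: S c) (simp_all add: sum_negf cone_sum sum_subtractf)

section \<open>Relations between the differential, \<open>cone\<close> and
  \<open>homotopy\<close>\<close>

text \<open>Two sets inserted into the first gap can be inserted in either order, with opposite
  signs; so can one set in the first gap and one further on. Two sets further on are left to the
  induction hypothesis.\<close>

lemma bd_bd:
  assumes "flag S M ts" "finite M"
  shows "bd S (bd S c) ts = 0"
  using assms
proof (induction ts arbitrary: S c)
  case (Cons T ts)
  then have fT: "finite T" using flag_subset[of T M ts] finite_subset[of T M] by simp
  have swap: "(\<Sum>U\<in>{S<..<T}. \<Sum>V\<in>{S<..<U}. c (V # U # T # ts))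
        = (\<Sum>V\<in>{S<..<T}. \<Sum>U\<in>{V<..<T}. c (V # U # T # ts))"
  proof -
    have "(\<Sum>U\<in>{S<..<T}. \<Sum>V\<in>{S<..<U}. c (V # U # T # ts))
        = (\<Sum>U\<in>{S<..<T}. \<Sum>V\<in>{V \<in> {S<..<T}. V \<subset> U}. c (V # U # T # ts))"
      by (intro sum.cong greaterThanLessThan_restrict) auto
    also have "\<dots> = (\<Sum>V\<in>{S<..<T}. \<Sum>U\<in>{U \<in> {S<..<T}. V \<subset> U}. c (V # U # T # ts))"
      by (intro sum.swap_restrict finite_between fT)
    also have "\<dots> = (\<Sum>V\<in>{S<..<T}. \<Sum>U\<in>{V<..<T}. c (V # U # T # ts))"
      by (intro sum.cong greaterThanLessThan_restrict(2)[symmetric]) auto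
    finally show ?thesis .
  qed
  have "bd T (bd T (\<lambda>us. c (T # us))) ts = 0"
    using Cons by auto
  then show ?case
    by (simp add: bd_diff bd_minus bd_sum sum_subtractf sum_negf swap)
qed simp

text \<open>Refining a flag and moving x to the front commute up to the shift of indices caused by
  the additional first set.\<close>

lemma bd_cone:
  assumes "flag S M ts" "finite M" "x \<notin> S"
  shows "bd S (cone x S f) ts = - cone x S (bd (insert x S) f) ts"
  using assms
proof (induction ts arbitrary: S f)
  case (Cons T ts)
  then have fT: "finite T" and ST: "S \<subset> T"
    using flag_subset[of T M ts] finite_subset[of T M] by simp_all
  consider "T = insert x S" | "x \<in> T" "T \<noteq> insert x S" | "x \<notin> T" by auto
  then show ?case
  proof cases
    case 1
    have "{S<..<T} = {}" using 1 by auto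
    then show ?thesis using 1 by simp
  next
    case 2
    \<comment> \<open>Here x enters in company, so \<open>cone\<close> sees only the refinements
      that isolate it: x is split off as the first or as the second half of the step. Both lead to
      \<open>f (T # ts)\<close>, with opposite signs.\<close>
    have "(\<Sum>U\<in>{S<..<T}. cone x S f (U # T # ts))
      = (\<Sum>U\<in>{insert x S, T - {x}}. cone x S f (U # T # ts))"
      using 2 ST Cons.prems fT by (intro sum.mono_neutral_right finite_between) auto
    also have "\<dots> = 0" using 2 Cons.prems
      by (subst sum.insert) (auto simp: insert_absorb)
    finally show ?thesis using 2 by (simp add: bd_zero)
  next
    case 3
    then have neq: "T \<noteq> insert x S" by auto
    have "(\<Sum>U\<in>{S<..<T}. cone x S f (U # T # ts))
       = (\<Sum>U\<in>{S<..<T}. cone x T (\<lambda>us. f (insert x U # insert x T # us)) ts)"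
      using 3 by (intro sum.cong) auto
    also have "\<dots> = (\<Sum>V\<in>{insert x S<..<insert x T}. cone x T (\<lambda>us. f (V # insert x T # us)) ts)"
      using 3 Cons.prems
      by (intro sum.reindex_bij_witness[of _ "\<lambda>V. V - {x}" "insert x"]) auto
    finally show ?thesis
      using 3 neq Cons by (simp add: cone_diff cone_minus cone_sum bd_minus)
  qed
qed simp

text \<open>The cases are the ways in which x meets the first step. If x enters alone, only the cone
  term sees the flag. If x enters in company, the flag is matched with its refinement that splits x
  off last, and only \<open>bd S (homotopy x S c)\<close> contributes. If x enters later, the terms
  from the first gap cancel and the induction hypothesis remains. The empty flag is excluded by
  \<open>x \<in> M\<close>.\<close>

lemma homotopy_formula:
  assumes "flag S M ts" "finite M" "x \<notin> S" "x \<in> M"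
  shows "c ts = bd S (homotopy x S c) ts + homotopy x S (bd S c) ts
    + cone x S (\<lambda>us. c (insert x S # us)) ts"
  using assms
proof (induction ts arbitrary: S c)
  case (Cons T ts)
  then have fT: "finite T" and ST: "S \<subset> T"
    using flag_subset[of T M ts] finite_subset[of T M] by simp_all
  consider "T = insert x S" | "x \<in> T" "T \<noteq> insert x S" | "x \<notin> T" by auto
  then show ?case
  proof cases
    case 1
    have "{S<..<T} = {}" using 1 by auto
    then show ?thesis using 1 by (simp add: bd_zero)
  next
    case 2
    have "(\<Sum>U\<in>{S<..<T}. homotopy x S c (U # T # ts))
      = (\<Sum>U\<in>{T - {x}}. homotopy x S c (U # T # ts))"
      using 2 ST Cons.prems fT by (intro sum.mono_neutral_right finite_between) auto
    also have "\<dots> = - c (T # ts)" using 2 Cons.prems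
      by (auto simp: insert_absorb)
    finally show ?thesis using 2 by (simp add: bd_zero)
  next
    case 3
    then have neq: "T \<noteq> insert x S" by auto
    let ?e = "\<lambda>V. cone x T (\<lambda>us. c (V # insert x T # us)) ts"
    have sum1: "(\<Sum>U\<in>{S<..<T}. homotopy x S c (U # T # ts))
       = (\<Sum>U\<in>{S<..<T}. ?e (insert x U)) + (\<Sum>U\<in>{S<..<T}. ?e U)
         + (\<Sum>U\<in>{S<..<T}. homotopy x T (\<lambda>us. c (U # T # us)) ts)"
      unfolding sum.distrib[symmetric]
      using 3 by (intro sum.cong) (auto simp: algebra_simps)
    \<comment> \<open>A set strictly between S and \<open>insert x T\<close> either avoids x, and is
      then T or strictly below T, or arises by adding x to S or to a set strictly between S and T.
      The two families indexed by U cancel against \<open>sum1\<close>, T supplies the cone term of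
      the induction hypothesis, and \<open>insert x S\<close> cancels the cone term of the
      claim.\<close>
    have "{S<..<insert x T} = ({S<..<T} \<union> {T}) \<union> ({insert x S} \<union> insert x ` {S<..<T})"
      (is "?L = ?R")
    proof
      show "?R \<subseteq> ?L" using 3 ST Cons.prems by auto
      show "?L \<subseteq> ?R"
      proof
        fix V assume V: "V \<in> ?L"
        show "V \<in> ?R"
        proof (cases "x \<in> V")
          case True
          then have "V = insert x (V - {x})" by auto
          moreover have "V - {x} \<in> insert S {S<..<T}" using V True 3 Cons.prems by auto
          ultimately show ?thesis by blast
        next
          case False
          then show ?thesis using V by auto
        qed
      qed
    qed
    moreover have "({S<..<T} \<union> {T}) \<inter> ({insert x S} \<union> insert x ` {S<..<T}) = {}"
      using 3 by auto
    moreover have "{insert x S} \<inter> insert x ` {S<..<T} = {}"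
    proof -
      have "insert x S \<noteq> insert x U" if "U \<in> {S<..<T}" for U
      proof -
        have "S \<subset> U" "x \<notin> U" using that 3 by auto
        then show ?thesis using insert_psubset_insert[of S U x] by (simp add: psubset_eq)
      qed
      then show ?thesis by (simp add: image_iff)
    qed
    moreover have "inj_on (insert x) {S<..<T}"
      using 3 by (intro inj_on_inverseI[of _ "\<lambda>V. V - {x}"]) auto
    ultimately have sum2: "(\<Sum>V\<in>{S<..<insert x T}. ?e V)
       = ((\<Sum>U\<in>{S<..<T}. ?e U) + ?e T) + (?e (insert x S) + (\<Sum>U\<in>{S<..<T}. ?e (insert x U)))"
      using finite_between[OF fT, of S]
      by (simp add: sum.union_disjoint sum.reindex del: Un_insert_left Un_insert_right)
    have IH: "c (T # ts) = bd T (homotopy x T (\<lambda>us. c (T # us))) ts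
        + homotopy x T (bd T (\<lambda>us. c (T # us))) ts + ?e T"
      using Cons.IH[of T "\<lambda>us. c (T # us)"] Cons.prems 3 by auto
    have be: "bd T (cone x T (\<lambda>us. c (insert x T # us))) ts
        = - cone x T (bd (insert x T) (\<lambda>us. c (insert x T # us))) ts"
      using Cons.prems 3 by (intro bd_cone) auto
    have "bd S (homotopy x S c) (T # ts) = - (\<Sum>U\<in>{S<..<T}. homotopy x S c (U # T # ts))
        + bd T (cone x T (\<lambda>us. c (insert x T # us))) ts + bd T (homotopy x T (\<lambda>us. c (T # us))) ts"
      using 3 by (simp add: bd_diff bd_minus)
    then show ?thesis
      using 3 neq unfolding sum1
      by (simp add: sum2 IH be cone_diff cone_minus cone_sum
          homotopy_diff homotopy_minus homotopy_sum bd_minus bd_diff)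
  qed
qed auto

section \<open>Cycles of the flag complex: exactness and the top class\<close>

text \<open>The cycle condition in degree \<open>l\<close> for a coefficient function. Writing the
  degree as \<open>Suc (length ts) = l\<close> leaves no condition in degree 0.\<close>

definition cocycle :: "'a set \<Rightarrow> 'a set \<Rightarrow> nat \<Rightarrow> ('a set list \<Rightarrow> 'k::comm_ring_1) \<Rightarrow> bool" where
  "cocycle S M l c \<longleftrightarrow> (\<forall>ts. flag S M ts \<longrightarrow> Suc (length ts) = l \<longrightarrow> bd S c ts = 0)"

lemma bd_insert:
  "x \<notin> S \<Longrightarrow> bd S c (insert x S # us) = - bd (insert x S) (\<lambda>us. c (insert x S # us)) us"
proof -
  have "{S<..<insert x S} = {}" by auto
  then show ?thesis by simp
qed

text \<open>No set lies strictly between \<open>S\<close> and \<open>insert x S\<close>, so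
  restriction to the flags that begin with \<open>insert x S\<close> anticommutes with
  \<open>bd\<close>.\<close>

lemma cocycle_first:
  assumes "cocycle S M (Suc l) c" "x \<notin> S"
  shows "cocycle (insert x S) M l (\<lambda>us. c (insert x S # us))"
  unfolding cocycle_def
proof (intro allI impI)
  fix ts assume ts: "flag (insert x S) M ts" "Suc (length ts) = l"
  have "flag S M (insert x S # ts)" using ts assms(2) by auto
  moreover have "Suc (length (insert x S # ts)) = Suc l" using ts by simp
  ultimately have "bd S c (insert x S # ts) = 0" using assms(1) unfolding cocycle_def by blast
  then show "bd (insert x S) (\<lambda>us. c (insert x S # us)) ts = 0"
    using bd_insert[OF assms(2), of c ts] by simp
qed

lemma cocycle_homotopy:
  assumes "cocycle S M l c" "flag S M ts" "length ts = l" "finite M" "x \<notin> S" "x \<in> M"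
  shows "c ts = bd S (homotopy x S c) ts + cone x S (\<lambda>us. c (insert x S # us)) ts"
proof -
  have "homotopy x S (bd S c) ts = homotopy x S (\<lambda>_. 0) ts"
    using assms by (intro homotopy_cong[where M = M]) (auto simp: cocycle_def)
  then show ?thesis using homotopy_formula[of S M ts x c] assms by (simp add: homotopy_zero)
qed

lemma card_Diff_insert_Suc:
  assumes "finite M" "x \<in> M" "x \<notin> S"
  shows "card (M - S) = Suc (card (M - insert x S))"
proof -
  have "M - S = insert x (M - insert x S)" using assms by auto
  then show ?thesis using assms(1) by (metis DiffE card_insert_disjoint finite_Diff insertI1)
qed

text \<open>Degree and rank drop together when c is restricted to the flags beginning with
  \<open>insert x S\<close>, so the restriction is again outside the top degree and has a primitive
  e by induction. Then \<open>cone\<close> carries e back, and \<open>homotopy\<close> accounts for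
  the difference.\<close>

lemma cocycle_exact:
  assumes "finite M" "S \<subseteq> M" "l \<noteq> card (M - S)" "cocycle S M l c"
  shows "\<exists>e. \<forall>ts. flag S M ts \<longrightarrow> length ts = l \<longrightarrow> c ts = bd S e ts"
  using assms
proof (induction "card (M - S)" arbitrary: S l c)
  case 0
  then have "length ts \<noteq> l" if "flag S M ts" for ts
    using flag_length[OF that] by simp
  then show ?case by blast
next
  case (Suc m)
  have "M - S \<noteq> {}" using Suc.hyps(2) by (intro notI) simp
  then obtain x where x: "x \<in> M" "x \<notin> S" by blast
  then have m: "m = card (M - insert x S)"
    using Suc.hyps(2) card_Diff_insert_Suc[OF Suc.prems(1) x] by linarith
  show ?case
  proof (cases l)
    case 0
    then show ?thesis using x by auto
  next
    case (Suc k)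
    have "\<exists>e. \<forall>ts. flag (insert x S) M ts \<longrightarrow> length ts = k
        \<longrightarrow> c (insert x S # ts) = bd (insert x S) e ts"
    proof (rule Suc.hyps(1))
      show "cocycle (insert x S) M k (\<lambda>us. c (insert x S # us))"
        using Suc.prems(4) x(2) unfolding \<open>l = Suc k\<close> by (rule cocycle_first)
      show "k \<noteq> card (M - insert x S)"
        using Suc.prems(3) \<open>l = Suc k\<close> unfolding Suc.hyps(2)[symmetric] m[symmetric] by blast
    qed (use Suc.prems(1,2) x(1) m in auto)
    then obtain e where e: "\<And>ts. flag (insert x S) M ts \<Longrightarrow> length ts = k
        \<Longrightarrow> c (insert x S # ts) = bd (insert x S) e ts" by blast
    \<comment> \<open>The minus sign before \<open>cone x S e\<close> compensates the one in
      \<open>bd_cone\<close>.\<close>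
    have "c ts = bd S (\<lambda>us. homotopy x S c us - cone x S e us) ts"
      if ts: "flag S M ts" "length ts = l" for ts
    proof -
      have "cone x S (\<lambda>us. c (insert x S # us)) ts = cone x S (bd (insert x S) e) ts"
      proof (rule cone_cong[OF _ ts(1)])
        show "c (insert x S # us) = bd (insert x S) e us"
          if "flag (insert x S) M us" "Suc (length us) = length ts" for us
          using that ts(2) \<open>l = Suc k\<close> by (intro e) simp_all
      qed
      moreover have "bd S (cone x S e) ts = - cone x S (bd (insert x S) e) ts"
        using ts x Suc.prems by (intro bd_cone[where M = M]) simp_all
      moreover have "c ts = bd S (homotopy x S c) ts + cone x S (\<lambda>us. c (insert x S # us)) ts"
        using ts x Suc.prems by (intro cocycle_homotopy[where M = M]) simp_all
      ultimately show ?thesis by (simp only: bd_diff diff_minus_eq_add)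
    qed
    then show ?thesis by blast
  qed
qed

primrec full_flag :: "'a set \<Rightarrow> 'a list \<Rightarrow> 'a set list" where
  "full_flag S [] = []"
| "full_flag S (x # xs) = insert x S # full_flag (insert x S) xs"

lemma length_full_flag [simp]: "length (full_flag S xs) = length xs"
  by (induction xs arbitrary: S) auto

lemma flag_full_flag: "distinct xs \<Longrightarrow> S \<inter> set xs = {} \<Longrightarrow> flag S (S \<union> set xs) (full_flag S xs)"
proof (induction xs arbitrary: S)
  case (Cons x xs)
  then have "flag (insert x S) (insert x S \<union> set xs) (full_flag (insert x S) xs)"
    by (intro Cons.IH) auto
  then show ?case using Cons.prems by auto
qed simp

text \<open>In the top degree the homotopy term would be evaluated at flags longer than any that
  exist. Hence c is the cone over its restriction to the flags that begin with the first letter of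
  \<open>xs\<close>, and peeling off the letters in order leaves only the value at
  \<open>full_flag S xs\<close>.\<close>

lemma top_cocycle_unique:
  assumes "finite M" "distinct xs" "S \<subseteq> M" "M - S = set xs"
    and "cocycle S M (length xs) c" "c (full_flag S xs) = 0"
    and "flag S M ts" "length ts = length xs"
  shows "c ts = 0"
  using assms
proof (induction xs arbitrary: S c ts)
  case (Cons x xs)
  have x: "x \<in> M" "x \<notin> S" using Cons.prems(4) by auto
  have first: "c (insert x S # us) = 0" if "flag (insert x S) M us" "Suc (length us) = length ts" for us
  proof (rule Cons.IH[of "insert x S" "\<lambda>us. c (insert x S # us)"])
    show "cocycle (insert x S) M (length xs) (\<lambda>us. c (insert x S # us))"
      using Cons.prems(5) x(2) unfolding list.size(4) add_Suc_right add_0_right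
      by (rule cocycle_first)
    show "M - insert x S = set xs"
      using Cons.prems(2,4) by (metis Diff_insert Diff_insert_absorb distinct.simps(2) list.simps(15))
    show "c (insert x S # full_flag (insert x S) xs) = 0" using Cons.prems(6) by simp
    show "length us = length xs" using that(2) Cons.prems(8) by simp
  qed (use that(1) x(1) Cons.prems(1-3) in simp_all)
  have "cone x S (\<lambda>us. c (insert x S # us)) ts = cone x S (\<lambda>_. 0) ts"
    by (rule cone_cong[OF first Cons.prems(7)])
  moreover have "bd S (homotopy x S c) ts = bd S (\<lambda>_. 0) ts"
  proof (rule bd_cong[OF _ Cons.prems(7)])
    fix us assume us: "flag S M us" "length us = Suc (length ts)"
    have "card (M - S) = length ts"
      using Cons.prems(4,8) distinct_card[OF Cons.prems(2)] by simp
    then show "homotopy x S c us = 0" using flag_length[OF us(1) Cons.prems(1)] us(2) by simp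
  qed
  moreover have "c ts = bd S (homotopy x S c) ts + cone x S (\<lambda>us. c (insert x S # us)) ts"
    by (rule cocycle_homotopy[OF Cons.prems(5,7,8,1) x(2,1)])
  ultimately show ?case by (simp only: bd_zero cone_zero add_0_right)
qed simp

text \<open>The witness is an iterated cone. On a maximal flag its value is the sign of the order in
  which the elements are added, relative to \<open>xs\<close>: this is the fundamental cycle of the
  barycentric subdivision of the boundary of a simplex.\<close>

lemma top_cocycle_exists:
  assumes "finite M" "distinct xs" "S \<subseteq> M" "M - S = set xs"
  shows "\<exists>c. cocycle S M (length xs) c \<and> c (full_flag S xs) = (1::'k::comm_ring_1)"
  using assms
proof (induction xs arbitrary: S)
  case Nil
  show ?case by (auto simp: cocycle_def intro: exI[of _ "\<lambda>_. 1"])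
next
  case (Cons x xs)
  have x: "x \<in> M" "x \<notin> S" using Cons.prems(4) by auto
  have "M - insert x S = set xs"
    using Cons.prems(2,4) by (metis Diff_insert Diff_insert_absorb distinct.simps(2) list.simps(15))
  then obtain e :: "'a set list \<Rightarrow> 'k" where
    e: "cocycle (insert x S) M (length xs) e" "e (full_flag (insert x S) xs) = 1"
    using Cons.IH[of "insert x S"] Cons.prems(1-3) x(1) by auto
  have "bd S (cone x S e) ts = 0" if ts: "flag S M ts" "length ts = length xs" for ts
  proof -
    have "cone x S (bd (insert x S) e) ts = cone x S (\<lambda>_. 0) ts"
      using e(1) ts(2) unfolding cocycle_def by (intro cone_cong[OF _ ts(1)]) simp
    then show ?thesis
      using bd_cone[OF ts(1) Cons.prems(1) x(2), of e] by (simp only: cone_zero minus_zero)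
  qed
  then have "cocycle S M (length (x # xs)) (cone x S e)" by (simp add: cocycle_def)
  then show ?case using e(2) by (intro exI[of _ "cone x S e"]) simp
qed

section \<open>Ordered partitions above a word\<close>

text \<open>The first letter always opens a block, so its membership in \<open>A\<close> is never
  tested; hence the separate roles of \<open>hd w\<close> and \<open>tl w\<close> below.\<close>

primrec cuts :: "'a set \<Rightarrow> 'a list \<Rightarrow> 'a list list" where
  "cuts A [] = []"
| "cuts A (a # w) = (if w = [] \<or> hd w \<in> A then [a] # cuts A w else (a # hd (cuts A w)) # tl (cuts A w))"

lemma cut_eq_Nil_iff [simp]: "cuts A w = [] \<longleftrightarrow> w = []"
  by (cases w) auto

lemma concat_cut [simp]: "concat (cuts A w) = w"
proof (induction w)
  case (Cons a w)
  show ?case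
  proof (cases "w = [] \<or> hd w \<in> A")
    case False
    then have "concat (hd (cuts A w) # tl (cuts A w)) = w" using Cons by simp
    then show ?thesis using False by simp
  qed (use Cons in auto)
qed simp

lemma Nil_notin_cut: "[] \<notin> set (cuts A w)"
proof (induction w)
  case (Cons a w)
  then show ?case using list.set_sel(2)[of "cuts A w"] by auto
qed simp

lemma hd_hd_cut: "w \<noteq> [] \<Longrightarrow> hd (hd (cuts A w)) = hd w"
  by (cases w) auto

lemma hd_tl_cut: "hd ` set (tl (cuts A w)) = A \<inter> set (tl w)"
proof (induction w)
  case (Cons a w)
  show ?case
  proof (cases w)
    case (Cons b v)
    then have "set (cuts A w) = insert (hd (cuts A w)) (set (tl (cuts A w)))"
      by (metis cut_eq_Nil_iff list.distinct(1) list.exhaust_sel list.simps(15))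
    then have "hd ` set (cuts A w) = insert b (A \<inter> set v)"
      using hd_hd_cut[of w A] Cons.IH \<open>w = b # v\<close> by simp
    then show ?thesis using Cons.IH \<open>w = b # v\<close> by auto
  qed simp
qed simp

lemma hd_cut:
  assumes "w \<noteq> []"
  shows "hd ` set (cuts A w) = insert (hd w) (A \<inter> set (tl w))"
proof -
  have "set (cuts A w) = insert (hd (cuts A w)) (set (tl (cuts A w)))"
    using assms by (metis cut_eq_Nil_iff list.exhaust_sel list.simps(15))
  then show ?thesis using hd_hd_cut[OF assms, of A] hd_tl_cut[of A w] by simp
qed

lemma cut_append: "v = [] \<or> hd v \<in> A \<Longrightarrow> cuts A (u @ v) = cuts A u @ cuts A v"
proof (induction u)
  case (Cons a u)
  then show ?case by (cases "u = []") auto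
qed simp

lemma cut_trivial: "A \<inter> set (tl b) = {} \<Longrightarrow> b \<noteq> [] \<Longrightarrow> cuts A b = [b]"
proof (induction b)
  case (Cons a b)
  show ?case
  proof (cases b)
    case (Cons c d)
    then have "cuts A b = [b]" using Cons.IH Cons.prems by auto
    then show ?thesis using Cons Cons.prems by auto
  qed simp
qed simp

lemma cut_all: "set (tl w) \<subseteq> A \<Longrightarrow> cuts A w = map (\<lambda>a. [a]) w"
proof (induction w)
  case (Cons a w)
  then show ?case by (cases w) auto
qed simp

lemma cut_concat: "(\<And>b. b \<in> set bs \<Longrightarrow> b \<noteq> [] \<and> hd b \<in> A) \<Longrightarrow>
    cuts A (concat bs) = concat (map (cuts A) bs)"
proof (induction bs)
  case (Cons b bs)
  have "concat bs = [] \<or> hd (concat bs) \<in> A"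
    using Cons.prems by (cases bs) auto
  then show ?case using Cons cut_append[of "concat bs" A b] by simp
qed simp

text \<open>Without repeated letters, the first letter of a block occurs nowhere else, so no cut
  falls inside a block.\<close>

lemma cut_heads:
  assumes "distinct (concat bs)" "[] \<notin> set bs"
  shows "cuts (hd ` set bs) (concat bs) = bs"
proof -
  have "cuts (hd ` set bs) b = [b]" if b: "b \<in> set bs" for b
  proof (rule cut_trivial)
    show "hd ` set bs \<inter> set (tl b) = {}"
    proof (rule ccontr)
      assume "\<not> ?thesis"
      then obtain b' where b': "b' \<in> set bs" "hd b' \<in> set (tl b)" by auto
      have "hd b' \<in> set b'" "hd b' \<in> set b" using b b' assms(2) by (metis list.set_sel)+
      then have "b' = b" using assms(1) b b'(1) by (auto simp: distinct_concat_iff)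
      moreover have "distinct b" using assms(1) b by (auto simp: distinct_concat_iff)
      ultimately show False using b b'(2) assms(2) by (cases b) auto
    qed
  qed (use b assms(2) in auto)
  then have "map (cuts (hd ` set bs)) bs = map (\<lambda>b. [b]) bs" by simp
  moreover have "cuts (hd ` set bs) (concat bs) = concat (map (cuts (hd ` set bs)) bs)"
    using assms(2) by (intro cut_concat) auto
  ultimately show ?thesis by (simp only: concat_map_singleton list.map_ident)
qed

section \<open>Ordered partitions, their order and its extremal elements\<close>

definition word :: "nat \<Rightarrow> nat list \<Rightarrow> bool" where
  "word n w \<longleftrightarrow> distinct w \<and> set w = {1..n}"

abbreviation blocks :: "nat list \<Rightarrow> nat set \<Rightarrow> nat list set" where
  "blocks w A \<equiv> set (cuts A w)"

lemma opleq_trans: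
  assumes "opleq L M" "opleq M N"
  shows "opleq L N"
  unfolding opleq_def
proof
  fix b assume "b \<in> L"
  then obtain bs where bs: "set bs \<subseteq> M" "b = concat bs" using assms(1) by (auto simp: opleq_def)
  then have "\<forall>c\<in>set bs. \<exists>cs. set cs \<subseteq> N \<and> c = concat cs" using assms(2) by (auto simp: opleq_def)
  then obtain f where f: "\<And>c. c \<in> set bs \<Longrightarrow> set (f c) \<subseteq> N"
    "\<And>c. c \<in> set bs \<Longrightarrow> concat (f c) = c" by metis
  have "concat (concat xs) = concat (map concat xs)" for xs :: "nat list list list"
    by (induction xs) auto
  then have "concat (concat (map f bs)) = concat (map (concat \<circ> f) bs)"
    by (simp only: list.map_comp)
  also have "map (concat \<circ> f) bs = bs" using f(2) by (intro map_idI) simp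
  finally have "b = concat (concat (map f bs))" using bs(2) by simp
  moreover have "set (concat (map f bs)) \<subseteq> N" using f(1) by auto
  ultimately show "\<exists>bs. set bs \<subseteq> N \<and> b = concat bs" by blast
qed

text \<open>All blocks of the coarser cut begin with letters of \<open>B\<close>, so cutting them
  one by one at \<open>B\<close> amounts to cutting \<open>w\<close> at \<open>B\<close>.\<close>

lemma opleq_blocks:
  assumes "w \<noteq> []" "hd w \<in> B" "A \<subseteq> B"
  shows "opleq (blocks w A) (blocks w B)"
  unfolding opleq_def
proof
  fix b assume b: "b \<in> blocks w A"
  have "cuts B (concat (cuts A w)) = concat (map (cuts B) (cuts A w))"
  proof (rule cut_concat)
    fix b assume b: "b \<in> set (cuts A w)"
    then have "hd b \<in> hd ` set (cuts A w)" by (rule imageI)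
    then have "hd b \<in> B" unfolding hd_cut[OF assms(1)] using assms(2,3) by auto
    then show "b \<noteq> [] \<and> hd b \<in> B" using b Nil_notin_cut[of A w] by metis
  qed
  then have "set (cuts B b) \<subseteq> blocks w B" using b by auto
  then show "\<exists>bs. set bs \<subseteq> blocks w B \<and> b = concat bs" by (intro exI[of _ "cuts B b"]) simp
qed

lemma opleq_imp_hd_subset:
  assumes "opleq L M" "[] \<notin> L" "[] \<notin> M"
  shows "hd ` L \<subseteq> hd ` M"
proof
  fix x assume "x \<in> hd ` L"
  then obtain b where b: "b \<in> L" "x = hd b" by auto
  then obtain bs where bs: "set bs \<subseteq> M" "b = concat bs" using assms(1) by (auto simp: opleq_def)
  have "b \<noteq> []" using b assms(2) by auto
  then obtain c cs where c: "bs = c # cs" using bs by (cases bs) auto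
  then have "c \<in> M" "c \<noteq> []" using bs assms(3) by auto
  then show "x \<in> hd ` M" using b bs c by auto
qed

lemma PiO_E:
  assumes "L \<in> PiO n"
  shows "[] \<notin> L" "finite L" "b \<in> L \<Longrightarrow> set b \<subseteq> {1..n}"
    "b \<in> L \<Longrightarrow> c \<in> L \<Longrightarrow> x \<in> set b \<Longrightarrow> x \<in> set c \<Longrightarrow> b = c"
    "x \<in> {1..n} \<Longrightarrow> \<exists>b\<in>L. x \<in> set b"
    "b \<in> L \<Longrightarrow> distinct b"
  using assms unfolding PiO_def ordered_partition_def by blast+

lemma set_in_PiO:
  assumes "[] \<notin> set bs" "word n (concat bs)"
  shows "set bs \<in> PiO n"
  using assms unfolding PiO_def ordered_partition_def word_def distinct_concat_iff by auto

lemma blocks_in_PiO: "word n w \<Longrightarrow> blocks w A \<in> PiO n"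
  by (intro set_in_PiO) (simp_all add: Nil_notin_cut)

lemma PiO_obtain_list:
  assumes "L \<in> PiO n"
  obtains bs where "set bs = L" "word n (concat bs)"
proof -
  obtain bs where bs: "set bs = L" "distinct bs"
    using PiO_E(2)[OF assms] finite_distinct_list by blast
  have "distinct (concat bs)"
    using assms bs distinct_removeAll[OF bs(2)]
    unfolding PiO_def ordered_partition_def distinct_concat_iff by blast
  moreover have "set (concat bs) = {1..n}"
    using assms bs unfolding PiO_def ordered_partition_def by auto
  ultimately show ?thesis using that bs(1) unfolding word_def by blast
qed

lemma PiO_subset_eq:
  assumes "L \<in> PiO n" "M \<in> PiO n" "L \<subseteq> M"
  shows "L = M"
proof
  show "M \<subseteq> L"
  proof
    fix b assume b: "b \<in> M"
    then have "b \<noteq> []" using PiO_E(1)[OF assms(2)] by auto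
    then have h: "hd b \<in> set b" by simp
    then have "hd b \<in> {1..n}" using PiO_E(3)[OF assms(2) b] by blast
    then obtain c where c: "c \<in> L" "hd b \<in> set c" using PiO_E(5)[OF assms(1)] by blast
    then have "b = c" using PiO_E(4)[OF assms(2) b _ h] assms(3) by blast
    then show "b \<in> L" using c by simp
  qed
qed fact

text \<open>The blocks that spell out \<open>w\<close> already cover all letters, so no block of
  \<open>L\<close> is left over and \<open>cut_heads\<close> applies.\<close>

lemma PiO_above_word:
  assumes "L \<in> PiO n" "word n w" "opleq {w} L"
  shows "blocks w (hd ` L) = L"
proof -
  obtain bs where bs: "set bs \<subseteq> L" "w = concat bs" using assms(3) by (auto simp: opleq_def)
  have ne: "[] \<notin> set bs" using bs PiO_E(1)[OF assms(1)] by auto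
  have "set bs \<in> PiO n" using ne bs(2) assms(2) by (intro set_in_PiO) simp_all
  then have "set bs = L" using assms(1) bs(1) by (intro PiO_subset_eq)
  then show ?thesis using cut_heads[of bs] ne bs(2) assms(2) by (auto simp: word_def)
qed

lemma word_neq_Nil: "word n w \<Longrightarrow> n \<ge> 1 \<Longrightarrow> w \<noteq> []"
  by (auto simp: word_def)

lemma hd_blocks:
  assumes "word n w" "n \<ge> 1" "hd w \<in> A" "A \<subseteq> {1..n}"
  shows "hd ` blocks w A = A"
proof -
  have "w \<noteq> []" using assms word_neq_Nil by blast
  then obtain a v where "w = a # v" by (cases w) auto
  then show ?thesis using hd_cut[of w A] assms by (auto simp: word_def)
qed

lemma blocks_hd:
  assumes "word n w" "n \<ge> 1"
  shows "blocks w {hd w} = {w}"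
proof -
  have "w \<noteq> []" using assms word_neq_Nil by blast
  then have "cuts {hd w} w = [w]"
    using assms(1) by (intro cut_trivial) (auto simp: word_def neq_Nil_conv)
  then show ?thesis by simp
qed

lemma blocks_all:
  assumes "word n w"
  shows "blocks w {1..n} = (\<lambda>i. [i]) ` {1..n}"
proof -
  have "set (tl w) \<subseteq> {1..n}" using assms by (cases w) (auto simp: word_def)
  then show ?thesis using assms by (simp add: cut_all word_def)
qed

text \<open>Concatenating the blocks of \<open>L\<close> in any order gives a one-block partition
  below \<open>L\<close>. Conversely, a block of a partition below \<open>{w}\<close> is a nonempty
  concatenation of copies of \<open>w\<close>, and having no repeated letter it is a single
  copy.\<close>

lemma op_minimal_iff:
  assumes "n \<ge> 1"
  shows "op_minimal n L \<longleftrightarrow> (\<exists>w. word n w \<and> L = {w})"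
proof
  assume L: "op_minimal n L"
  then have "L \<in> PiO n" by (simp add: op_minimal_def)
  then obtain bs where bs: "set bs = L" "word n (concat bs)" by (rule PiO_obtain_list)
  have "{concat bs} \<in> PiO n"
    using blocks_in_PiO[OF bs(2)] blocks_hd[OF bs(2) assms] by metis
  moreover have "opleq {concat bs} L" using bs(1) by (auto simp: opleq_def)
  ultimately have "{concat bs} = L" using L by (simp add: op_minimal_def)
  then show "\<exists>w. word n w \<and> L = {w}" using bs(2) by blast
next
  assume "\<exists>w. word n w \<and> L = {w}"
  then obtain w where w: "word n w" "L = {w}" by blast
  have P: "{w} \<in> PiO n" using blocks_in_PiO[OF w(1)] blocks_hd[OF w(1) assms] by metis
  have "M = {w}" if M: "M \<in> PiO n" "opleq M {w}" for M
  proof -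
    have "b = w" if b: "b \<in> M" for b
    proof -
      obtain bs where bs: "set bs \<subseteq> {w}" "b = concat bs" using M(2) b by (auto simp: opleq_def)
      have "b \<noteq> []" using b PiO_E(1)[OF M(1)] by auto
      then obtain c cs where "bs = c # cs" using bs by (cases bs) auto
      then obtain v where bw: "b = w @ v" using bs by auto
      have "set b \<subseteq> set w" using PiO_E(3)[OF M(1) b] w(1) by (simp only: word_def)
      moreover have "distinct b" using PiO_E(6)[OF M(1) b] .
      ultimately have "v = []" unfolding bw by (cases v) auto
      then show ?thesis using bw by simp
    qed
    then have "M \<subseteq> {w}" by blast
    then show ?thesis using PiO_subset_eq[OF M(1) P] by simp
  qed
  then show "op_minimal n L" using P w(2) by (simp add: op_minimal_def)
qed

lemma singletons_in_PiO: "(\<lambda>i. [i]) ` {1..n} \<in> PiO n"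
  by (auto simp: PiO_def ordered_partition_def)

lemma op_maximal_iff: "op_maximal n L \<longleftrightarrow> L = (\<lambda>i. [i]) ` {1..n}"
proof
  assume L: "op_maximal n L"
  then have LP: "L \<in> PiO n" by (simp add: op_maximal_def)
  have "opleq L ((\<lambda>i. [i]) ` {1..n})"
    unfolding opleq_def
  proof
    fix b assume "b \<in> L"
    then have "set (map (\<lambda>i. [i]) b) \<subseteq> (\<lambda>i. [i]) ` {1..n}" using PiO_E(3)[OF LP] by auto
    moreover have "b = concat (map (\<lambda>i. [i]) b)" by simp
    ultimately show "\<exists>bs. set bs \<subseteq> (\<lambda>i. [i]) ` {1..n} \<and> b = concat bs" by blast
  qed
  then show "L = (\<lambda>i. [i]) ` {1..n}" using L singletons_in_PiO by (auto simp: op_maximal_def)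
next
  assume L: "L = (\<lambda>i. [i]) ` {1..n}"
  have "M = L" if M: "M \<in> PiO n" "opleq L M" for M
  proof -
    have "[i] \<in> M" if i: "[i] \<in> L" for i
    proof -
      obtain bs where bs: "set bs \<subseteq> M" "[i] = concat bs" using M(2) i by (auto simp: opleq_def)
      have "[] \<notin> set bs" using bs PiO_E(1)[OF M(1)] by auto
      moreover obtain c cs where c: "bs = c # cs" using bs by (cases bs) auto
      ultimately have "c = [i]" using bs(2) by (cases c) auto
      then show ?thesis using bs(1) c by auto
    qed
    then have "L \<subseteq> M" using L by blast
    then show ?thesis using PiO_subset_eq[of L n M] M(1) L singletons_in_PiO by auto
  qed
  then show "op_maximal n L" using L singletons_in_PiO by (simp add: op_maximal_def)
qed

section \<open>Chains above a word as flags\<close>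

text \<open>The entry \<open>{w}\<close> is \<open>blocks w {hd w}\<close>, the image of the initial
  set that flags leave out.\<close>

definition word_chain :: "nat list \<Rightarrow> nat set list \<Rightarrow> nat list set list" where
  "word_chain w ts = {w} # map (blocks w) ts"

text \<open>Stated for any \<open>L\<close> above \<open>{w}\<close>, so that the induction can move
  up the chain. Strictness passes to the sets of first letters because \<open>blocks w\<close>
  recovers the partitions from them.\<close>

lemma chain_imp_flag:
  assumes "word n w" "n \<ge> 1"
    and "\<And>M. M \<in> set (L # Ls) \<Longrightarrow> M \<in> PiO n" "opleq {w} L"
    and "successively opless (L # Ls)" "op_maximal n (last (L # Ls))"
  shows "flag (hd ` L) {1..n} (map ((`) hd) Ls) \<and> map (blocks w) (map ((`) hd) Ls) = Ls"
  using assms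
proof (induction Ls arbitrary: L)
  case Nil
  then show ?case by (auto simp: op_maximal_iff image_image)
next
  case (Cons M Ls)
  have LM: "opleq L M" "L \<noteq> M" using Cons.prems(5) by (auto simp: opless_def)
  have P: "L \<in> PiO n" "M \<in> PiO n" using Cons.prems(3) by auto
  have wM: "opleq {w} M" using opleq_trans[OF Cons.prems(4) LM(1)] .
  have eq: "blocks w (hd ` L) = L" "blocks w (hd ` M) = M"
    using PiO_above_word P Cons.prems(1,4) wM by blast+
  then have "hd ` L \<noteq> hd ` M" using LM(2) by metis
  moreover have "hd ` L \<subseteq> hd ` M" using opleq_imp_hd_subset[OF LM(1)] P PiO_E(1) by blast
  moreover have "flag (hd ` M) {1..n} (map ((`) hd) Ls) \<and> map (blocks w) (map ((`) hd) Ls) = Ls"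
    using Cons.prems wM by (intro Cons.IH) auto
  ultimately show ?case using eq(2) by auto
qed

lemma flag_imp_chain:
  assumes "word n w" "n \<ge> 1" "hd w \<in> A" "flag A {1..n} ts"
  shows "successively opless (blocks w A # map (blocks w) ts)
    \<and> last (blocks w A # map (blocks w) ts) = blocks w {1..n}"
  using assms(3,4)
proof (induction ts arbitrary: A)
  case (Cons T ts)
  have w: "w \<noteq> []" using assms word_neq_Nil by blast
  have AT: "A \<subseteq> T" "A \<noteq> T" "flag T {1..n} ts" using Cons.prems by auto
  have T: "T \<subseteq> {1..n}" by (rule flag_subset[OF AT(3)])
  then have A: "A \<subseteq> {1..n}" using AT(1) by simp
  have hT: "hd w \<in> T" using AT Cons.prems by auto
  have "opleq (blocks w A) (blocks w T)" by (rule opleq_blocks[OF w hT AT(1)])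
  moreover have "hd ` blocks w A \<noteq> hd ` blocks w T"
    using hd_blocks[OF assms(1,2) hT T] hd_blocks[OF assms(1,2) Cons.prems(1) A] AT(2) by simp
  then have "blocks w A \<noteq> blocks w T" by metis
  ultimately have "opless (blocks w A) (blocks w T)" by (simp add: opless_def)
  then show ?case using Cons.IH[OF hT AT(3)] by simp
qed simp

lemma chains_eq:
  assumes "n \<ge> 1"
  shows "chains n l = {word_chain w ts |w ts. word n w \<and> flag {hd w} {1..n} ts \<and> length ts = l}"
proof (intro equalityI subsetI)
  fix ch assume "ch \<in> chains n l"
  then have ch: "length ch = Suc l" "\<And>L. L \<in> set ch \<Longrightarrow> L \<in> PiO n"
    "\<And>i. i < l \<Longrightarrow> opless (ch ! i) (ch ! Suc i)" "op_minimal n (ch ! 0)" "op_maximal n (ch ! l)"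
    by (auto simp: chains_def is_chain_def)
  obtain L Ls where L: "ch = L # Ls" using ch(1) by (cases ch) auto
  obtain w where w: "word n w" "L = {w}" using ch(4) L op_minimal_iff[OF assms] by auto
  have "last ch = ch ! l" using ch(1) L by (subst last_conv_nth) auto
  moreover have "successively opless ch" using ch(1,3) by (auto simp: successively_conv_nth)
  ultimately have "flag (hd ` L) {1..n} (map ((`) hd) Ls) \<and> map (blocks w) (map ((`) hd) Ls) = Ls"
    using w ch(2,5) L assms by (intro chain_imp_flag) (auto simp: opleq_def intro: exI[of _ "[w]"])
  then show "ch \<in> {word_chain w ts |w ts. word n w \<and> flag {hd w} {1..n} ts \<and> length ts = l}"
    using w L ch(1) unfolding word_chain_def
    by (intro CollectI exI[of _ w] exI[of _ "map ((`) hd) Ls"]) auto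
next
  fix ch assume "ch \<in> {word_chain w ts |w ts. word n w \<and> flag {hd w} {1..n} ts \<and> length ts = l}"
  then obtain w ts where w: "word n w" "flag {hd w} {1..n} ts" "length ts = l"
    and ch: "ch = blocks w {hd w} # map (blocks w) ts"
    using blocks_hd[OF _ assms] by (auto simp: word_chain_def)
  have l: "length ch = Suc l" using ch w by simp
  then have "last ch = ch ! l" by (subst last_conv_nth) auto
  then have "ch ! l = blocks w {1..n}" using flag_imp_chain[OF w(1) assms _ w(2)] ch by simp
  then have "op_maximal n (ch ! l)" using op_maximal_iff blocks_all[OF w(1)] by simp
  moreover have "op_minimal n (ch ! 0)"
    using ch w(1) blocks_hd[OF w(1) assms] op_minimal_iff[OF assms] by auto
  moreover have "successively opless ch" using flag_imp_chain[OF w(1) assms _ w(2)] ch by simp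
  then have "\<forall>i<l. opless (ch ! i) (ch ! Suc i)" using l by (auto simp: successively_conv_nth)
  moreover have "\<forall>L\<in>set ch. L \<in> PiO n" using ch blocks_in_PiO[OF w(1)] by auto
  ultimately show "ch \<in> chains n l" using l by (simp add: chains_def is_chain_def)
qed

section \<open>Homology of the ordered partition poset\<close>

lemma finite_flags: "finite M \<Longrightarrow> finite {ts. flag S M ts \<and> length ts = l}"
proof (rule finite_subset)
  show "{ts. flag S M ts \<and> length ts = l} \<subseteq> {ts. set ts \<subseteq> Pow M \<and> length ts = l}"
    using flag_subset_mem by blast
  show "finite M \<Longrightarrow> finite {ts. set ts \<subseteq> Pow M \<and> length ts = l}"
    by (intro finite_lists_length_eq) simp
qed

lemma finite_words: "finite {w. word n w}"
proof (rule finite_subset)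
  show "{w. word n w} \<subseteq> {w. set w \<subseteq> {1..n} \<and> length w = n}"
    using distinct_card by (fastforce simp: word_def)
  show "finite {w. set w \<subseteq> {1..n} \<and> length w = n}"
    by (intro finite_lists_length_eq) simp
qed

lemma finite_chains:
  assumes "n \<ge> 1"
  shows "finite (chains n l)"
proof -
  have "chains n l = (\<Union>w\<in>{w. word n w}. word_chain w ` {ts. flag {hd w} {1..n} ts \<and> length ts = l})"
    unfolding chains_eq[OF assms] by blast
  then show ?thesis using finite_words finite_flags[of "{1..n}"] by simp
qed

section \<open>The differential of the poset in terms of flags\<close>

lemma del_nth_Cons_0 [simp]: "del_nth 0 (x # xs) = xs"
  by (simp add: del_nth_def)

lemma del_nth_Cons_Suc [simp]: "del_nth (Suc i) (x # xs) = x # del_nth i xs"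
  by (simp add: del_nth_def)

lemma set_del_nth: "set (del_nth i xs) \<subseteq> set xs"
  using set_take_subset[of i xs] set_drop_subset[of "Suc i" xs] by (auto simp: del_nth_def)

lemma map_del_nth: "map f (del_nth i xs) = del_nth i (map f xs)"
  by (simp add: del_nth_def take_map drop_map)

text \<open>Index j of a flag is index \<open>Suc j\<close> of its chain, whence the sign, and the
  range of j spares the last entry. Deletion at index 0 yields the sum over the first gap; deletion
  further on forces the first set to be T and recurses.\<close>

lemma sum_del_nth_eq_bd:
  assumes "finite M" "flag S M ts"
  shows "(\<Sum>us\<in>{us. flag S M us \<and> length us = Suc (length ts)}. \<Sum>j<length ts.
            if del_nth j us = ts then (- 1) ^ Suc j * f us else 0) = bd S f ts"
  using assms(2)
proof (induction ts arbitrary: S f)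
  case (Cons T ts)
  let ?F = "{us. flag S M us \<and> length us = Suc (length (T # ts))}"
  let ?h = "\<lambda>us. \<Sum>j<length ts. if del_nth (Suc j) us = T # ts then (- 1) ^ Suc (Suc j) * f us else 0"
  let ?G = "{us. flag T M us \<and> length us = Suc (length ts)}"
  have fin: "finite ?F" by (rule finite_flags[OF assms(1)])
  have ST: "S \<subset> T" "flag T M ts" using Cons.prems by simp_all
  have "(\<Sum>us\<in>?F. if del_nth 0 us = T # ts then (- 1) ^ Suc 0 * f us else 0)
      = (\<Sum>us\<in>(\<lambda>U. U # T # ts) ` {S<..<T}. - f us)"
  proof (rule sum.mono_neutral_cong_right[OF fin])
    show "(\<lambda>U. U # T # ts) ` {S<..<T} \<subseteq> ?F" using ST by auto
    show "\<forall>us\<in>?F - (\<lambda>U. U # T # ts) ` {S<..<T}.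
        (if del_nth 0 us = T # ts then (- 1) ^ Suc 0 * f us else 0) = 0"
    proof
      fix us assume us: "us \<in> ?F - (\<lambda>U. U # T # ts) ` {S<..<T}"
      then obtain U vs where "us = U # vs" by (cases us) auto
      then show "(if del_nth 0 us = T # ts then (- 1) ^ Suc 0 * f us else 0) = 0"
        using us by auto
    qed
  qed auto
  also have "\<dots> = - (\<Sum>U\<in>{S<..<T}. f (U # T # ts))"
    by (simp add: sum.reindex inj_on_def sum_negf)
  finally have first: "(\<Sum>us\<in>?F. if del_nth 0 us = T # ts then (- 1) ^ Suc 0 * f us else 0)
      = - (\<Sum>U\<in>{S<..<T}. f (U # T # ts))" .
  have "(\<Sum>us\<in>?F. ?h us)
      = (\<Sum>us\<in>(#) T ` ?G. ?h us)"
  proof (rule sum.mono_neutral_right[OF fin])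
    show "(#) T ` ?G \<subseteq> ?F" using ST by auto
    show "\<forall>us\<in>?F - (#) T ` ?G. ?h us = 0"
    proof
      fix us assume us: "us \<in> ?F - (#) T ` ?G"
      then obtain U vs where "us = U # vs" by (cases us) auto
      then show "?h us = 0"
        using us by (intro sum.neutral) auto
    qed
  qed
  also have "\<dots> = (\<Sum>us\<in>?G. \<Sum>j<length ts. if del_nth j us = ts then (- 1) ^ Suc (Suc j) * f (T # us) else 0)"
    by (subst sum.reindex) (auto simp: inj_on_def cong: if_cong)
  also have "\<dots> = - (\<Sum>us\<in>?G. \<Sum>j<length ts. if del_nth j us = ts then (- 1) ^ Suc j * f (T # us) else 0)"
    unfolding sum_negf[symmetric] by (intro sum.cong) auto
  also have "\<dots> = - bd T (\<lambda>us. f (T # us)) ts" by (simp only: Cons.IH[OF ST(2)])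
  finally show ?case using first
    by (simp only: length_Cons sum.lessThan_Suc_shift sum.distrib bd.simps diff_conv_add_uminus)
qed simp

lemma heads_blocks:
  assumes "word n w" "n \<ge> 1" "\<And>T. T \<in> set ts \<Longrightarrow> hd w \<in> T \<and> T \<subseteq> {1..n}"
  shows "map ((`) hd) (map (blocks w) ts) = ts"
  using hd_blocks[OF assms(1,2)] assms(3) by (simp add: map_idI)

lemma flag_hd_mem: "flag {hd w} M ts \<Longrightarrow> T \<in> set ts \<Longrightarrow> hd w \<in> T \<and> T \<subseteq> M"
  using flag_subset_mem by fast

lemma word_chain_inject:
  assumes "word n w" "n \<ge> 1" "flag {hd w} {1..n} ts"
    and "\<And>T. T \<in> set us \<Longrightarrow> hd w \<in> T \<and> T \<subseteq> {1..n}"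
  shows "word_chain w us = word_chain w ts \<longleftrightarrow> us = ts"
proof
  assume "word_chain w us = word_chain w ts"
  then have "map ((`) hd) (map (blocks w) us) = map ((`) hd) (map (blocks w) ts)"
    by (simp add: word_chain_def)
  then show "us = ts"
    using heads_blocks[OF assms(1,2,4)] heads_blocks[OF assms(1,2) flag_hd_mem[OF assms(3)]] by metis
qed simp

lemma word_chain_in_chains:
  "n \<ge> 1 \<Longrightarrow> word n w \<Longrightarrow> flag {hd w} {1..n} ts \<Longrightarrow> length ts = l \<Longrightarrow> word_chain w ts \<in> chains n l"
  unfolding chains_eq by blast

lemma chains_E:
  assumes "ch \<in> chains n l" "n \<ge> 1"
  obtains w ts where "word n w" "flag {hd w} {1..n} ts" "length ts = l" "ch = word_chain w ts"
  using assms(1) unfolding chains_eq[OF assms(2)] by blast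

text \<open>Deletion at a positive index keeps the first entry, so chains starting at other words do
  not contribute.\<close>

lemma bdry_word_chain:
  assumes n: "n \<ge> 1" and w: "word n w" and ts: "flag {hd w} {1..n} ts" "length ts = l"
  shows "bdry n (Suc l) c (word_chain w ts) = bd {hd w} (\<lambda>us. c (word_chain w us)) ts"
proof -
  let ?F = "{us. flag {hd w} {1..n} us \<and> length us = Suc l}"
  let ?g = "\<lambda>ch i. if del_nth i ch = word_chain w ts then (- 1) ^ i * c ch else 0"
  have del: "del_nth (Suc j) (word_chain w us) = word_chain w ts \<longleftrightarrow> del_nth j us = ts"
    if "us \<in> ?F" for us j
  proof -
    have "hd w \<in> T \<and> T \<subseteq> {1..n}" if "T \<in> set (del_nth j us)" for T
      using that set_del_nth[of j us] flag_hd_mem[of w "{1..n}" us T] \<open>us \<in> ?F\<close> by blast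
    then have "word_chain w (del_nth j us) = word_chain w ts \<longleftrightarrow> del_nth j us = ts"
      by (rule word_chain_inject[OF w n ts(1)])
    then show ?thesis by (simp add: word_chain_def map_del_nth)
  qed
  have "bdry n (Suc l) c (word_chain w ts) = (\<Sum>ch\<in>chains n (Suc l). \<Sum>i\<in>{1..<Suc l}. ?g ch i)"
    using word_chain_in_chains[OF n w ts] by (simp only: bdry_def diff_Suc_1 if_True)
  also have "\<dots> = (\<Sum>ch\<in>word_chain w ` ?F. \<Sum>i\<in>{1..<Suc l}. ?g ch i)"
  proof (rule sum.mono_neutral_right[OF finite_chains[OF n]])
    show "word_chain w ` ?F \<subseteq> chains n (Suc l)" using word_chain_in_chains[OF n w] by blast
    show "\<forall>ch\<in>chains n (Suc l) - word_chain w ` ?F. (\<Sum>i\<in>{1..<Suc l}. ?g ch i) = 0"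
    proof
      fix ch assume ch: "ch \<in> chains n (Suc l) - word_chain w ` ?F"
      then obtain v us where v: "ch = word_chain v us" "flag {hd v} {1..n} us" "length us = Suc l"
        using chains_E[OF _ n] by (metis DiffD1)
      then have "v \<noteq> w" using ch by blast
      have "del_nth i ch \<noteq> word_chain w ts" if "i \<in> {1..<Suc l}" for i
        using that v(1) \<open>v \<noteq> w\<close> by (cases i) (auto simp: word_chain_def)
      then show "(\<Sum>i\<in>{1..<Suc l}. ?g ch i) = 0" by (intro sum.neutral) simp
    qed
  qed
  also have "\<dots> = (\<Sum>us\<in>?F. \<Sum>i\<in>{1..<Suc l}. ?g (word_chain w us) i)"
  proof (rule sum.reindex_cong)
    show "inj_on (word_chain w) ?F"
    proof (rule inj_onI)
      fix us vs assume us: "us \<in> ?F" "vs \<in> ?F" "word_chain w us = word_chain w vs"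
      then show "us = vs"
        using word_chain_inject[OF w n, of vs us] flag_hd_mem[of w "{1..n}" us] by blast
    qed
  qed simp_all
  also have "\<dots> = (\<Sum>us\<in>?F. \<Sum>j<l. ?g (word_chain w us) (Suc j))"
    by (simp only: One_nat_def sum.atLeast_Suc_lessThan_Suc_shift o_def atLeast0LessThan)
  also have "\<dots> = (\<Sum>us\<in>?F. \<Sum>j<l. if del_nth j us = ts then (- 1) ^ Suc j * c (word_chain w us) else 0)"
    using del by (intro sum.cong refl) simp
  also have "\<dots> = bd {hd w} (\<lambda>us. c (word_chain w us)) ts"
    using sum_del_nth_eq_bd[OF _ ts(1), of "\<lambda>us. c (word_chain w us)"] ts(2) by simp
  finally show ?thesis .
qed

lemma Cgroup_eqI:
  assumes "n \<ge> 1" "c \<in> Cgroup n l" "c' \<in> Cgroup n l"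
    and "\<And>w ts. word n w \<Longrightarrow> flag {hd w} {1..n} ts \<Longrightarrow> length ts = l
      \<Longrightarrow> c (word_chain w ts) = c' (word_chain w ts)"
  shows "c = c'"
proof
  fix ch
  show "c ch = c' ch"
  proof (cases "ch \<in> chains n l")
    case True
    then show ?thesis using assms(1,4) by (metis chains_E)
  next
    case False
    then have "c ch = 0" "c' ch = 0" using assms(2,3) unfolding Cgroup_def by blast+
    then show ?thesis by simp
  qed
qed

lemma bdry_in_Cgroup: "bdry n (Suc l) c \<in> Cgroup n l"
  by (simp add: bdry_def Cgroup_def)

lemma cycles_iff:
  assumes n: "n \<ge> 1"
  shows "c \<in> cycles n l \<longleftrightarrow>
    c \<in> Cgroup n l \<and> (\<forall>w. word n w \<longrightarrow> cocycle {hd w} {1..n} l (\<lambda>ts. c (word_chain w ts)))"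
proof (cases l)
  case 0
  \<comment> \<open>In degree 0 truncated subtraction gives \<open>l - 1 = 0\<close>;
    \<open>bdry n 0\<close> still vanishes because \<open>{1..<0}\<close> is empty, which matches
    the empty condition in \<open>cocycle\<close>.\<close>
  then show ?thesis by (auto simp: cycles_def bdry_def cocycle_def)
next
  case (Suc k)
  have "bdry n l c = (\<lambda>_. 0) \<longleftrightarrow> (\<forall>w. word n w \<longrightarrow> cocycle {hd w} {1..n} l (\<lambda>ts. c (word_chain w ts)))"
    (is "?L \<longleftrightarrow> ?R")
  proof
    assume ?L
    then show ?R using bdry_word_chain[OF n, of _ _ k c] Suc by (auto simp: cocycle_def)
  next
    assume R: ?R
    have "bdry n (Suc k) c = (\<lambda>_. 0)"
    proof (rule Cgroup_eqI[OF n bdry_in_Cgroup])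
      show "bdry n (Suc k) c (word_chain w ts) = 0"
        if "word n w" "flag {hd w} {1..n} ts" "length ts = k" for w ts
        using R that Suc bdry_word_chain[OF n that, of c] by (simp add: cocycle_def)
    qed (simp add: Cgroup_def)
    then show ?L using Suc by simp
  qed
  then show ?thesis by (simp add: cycles_def)
qed

text \<open>Inverse to splitting a chain into one coefficient function per word.\<close>

definition of_words :: "nat \<Rightarrow> nat \<Rightarrow> (nat list \<Rightarrow> nat set list \<Rightarrow> 'k::comm_ring_1) \<Rightarrow> nat list set list \<Rightarrow> 'k" where
  "of_words n l g = (\<lambda>ch. if ch \<in> chains n l then g (the_elem (hd ch)) (map ((`) hd) (tl ch)) else 0)"

lemma of_words_in_Cgroup: "of_words n l g \<in> Cgroup n l"
  by (simp add: of_words_def Cgroup_def)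

lemma of_words_word_chain:
  assumes "n \<ge> 1" "word n w" "flag {hd w} {1..n} ts" "length ts = l"
  shows "of_words n l g (word_chain w ts) = g w ts"
  using word_chain_in_chains[OF assms] heads_blocks[OF assms(2,1) flag_hd_mem[OF assms(3)]]
  by (simp add: of_words_def word_chain_def)

section \<open>Boundaries and cycles in each degree\<close>

lemma boundaries_subset_cycles:
  assumes n: "n \<ge> 1"
  shows "boundaries n l \<subseteq> (cycles n l :: (nat list set list \<Rightarrow> 'k::comm_ring_1) set)"
proof
  fix b :: "nat list set list \<Rightarrow> 'k"
  assume "b \<in> boundaries n l"
  then obtain e where e: "b = bdry n (Suc l) e" by (auto simp: boundaries_def)
  have "cocycle {hd w} {1..n} l (\<lambda>ts. b (word_chain w ts))" if w: "word n w" for w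
    unfolding cocycle_def
  proof (intro allI impI)
    fix ts assume ts: "flag {hd w} {1..n} ts" "Suc (length ts) = l"
    have "bd {hd w} (\<lambda>us. b (word_chain w us)) ts = bd {hd w} (bd {hd w} (\<lambda>us. e (word_chain w us))) ts"
      by (rule bd_cong[OF _ ts(1)]) (simp add: e bdry_word_chain[OF n w] ts(2))
    also have "\<dots> = 0" by (rule bd_bd[OF ts(1)]) simp
    finally show "bd {hd w} (\<lambda>us. b (word_chain w us)) ts = 0" .
  qed
  then show "b \<in> cycles n l" using bdry_in_Cgroup by (simp add: cycles_iff[OF n] e)
qed

lemma card_word: "word n w \<Longrightarrow> n \<ge> 1 \<Longrightarrow> card ({1..n} - {hd w}) = n - 1"
  using word_neq_Nil[of n w] hd_in_set[of w] by (simp add: word_def card_Diff_singleton)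

text \<open>A primitive is chosen separately for each word, and \<open>of_words\<close> glues these
  choices.\<close>

lemma cycles_eq_boundaries:
  assumes n: "n \<ge> 1" and l: "l \<noteq> n - 1"
  shows "cycles n l = (boundaries n l :: (nat list set list \<Rightarrow> 'k::comm_ring_1) set)"
proof (rule equalityI[OF subsetI boundaries_subset_cycles[OF n]])
  fix c :: "nat list set list \<Rightarrow> 'k"
  assume c: "c \<in> cycles n l"
  have "\<exists>e. \<forall>ts. flag {hd w} {1..n} ts \<longrightarrow> length ts = l \<longrightarrow> c (word_chain w ts) = bd {hd w} e ts"
    if w: "word n w" for w
  proof (rule cocycle_exact)
    show "{hd w} \<subseteq> {1..n}" using w word_neq_Nil[OF w n] hd_in_set[of w] by (simp add: word_def)
    show "l \<noteq> card ({1..n} - {hd w})" using card_word[OF w n] l by simp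
    show "cocycle {hd w} {1..n} l (\<lambda>ts. c (word_chain w ts))" using c w cycles_iff[OF n] by blast
  qed simp
  then obtain e where e: "\<And>w ts. word n w \<Longrightarrow> flag {hd w} {1..n} ts \<Longrightarrow> length ts = l
      \<Longrightarrow> c (word_chain w ts) = bd {hd w} (e w) ts"
    by metis
  have "c = bdry n (Suc l) (of_words n (Suc l) e)"
  proof (rule Cgroup_eqI[OF n _ bdry_in_Cgroup])
    show "c \<in> Cgroup n l" using c by (simp add: cycles_def)
    fix w ts assume w: "word n w" and ts: "flag {hd w} {1..n} ts" "length ts = l"
    have "bd {hd w} (e w) ts = bd {hd w} (\<lambda>us. of_words n (Suc l) e (word_chain w us)) ts"
      by (rule bd_cong[OF _ ts(1)]) (simp add: of_words_word_chain[OF n w] ts(2))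
    then show "c (word_chain w ts) = bdry n (Suc l) (of_words n (Suc l) e) (word_chain w ts)"
      using e[OF w ts] bdry_word_chain[OF n w ts, of "of_words n (Suc l) e"] by simp
  qed
  then show "c \<in> boundaries n l" using of_words_in_Cgroup by (auto simp: boundaries_def)
qed

definition std_flag :: "nat list \<Rightarrow> nat set list" where
  "std_flag w = full_flag {hd w} (tl w)"

definition std_chain :: "nat list \<Rightarrow> nat list set list" where
  "std_chain w = word_chain w (std_flag w)"

lemma word_tl:
  assumes "word n w" "n \<ge> 1"
  shows "distinct (tl w)" "{hd w} \<subseteq> {1..n}" "{1..n} - {hd w} = set (tl w)" "length (tl w) = n - 1"
proof -
  obtain a v where "w = a # v" using word_neq_Nil[OF assms] by (cases w) auto
  then have v: "distinct v" "a \<notin> set v" "{1..n} = insert a (set v)" "w = a # v"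
    using assms(1) by (auto simp: word_def)
  show "distinct (tl w)" "{hd w} \<subseteq> {1..n}" "{1..n} - {hd w} = set (tl w)"
    using v by simp_all
  then show "length (tl w) = n - 1" using card_word[OF assms] distinct_card by metis
qed

lemma flag_std_flag:
  assumes "word n w" "n \<ge> 1"
  shows "flag {hd w} {1..n} (std_flag w)" "length (std_flag w) = n - 1"
proof -
  have "{hd w} \<inter> set (tl w) = {}" "{hd w} \<union> set (tl w) = {1..n}"
    using word_tl(2,3)[OF assms] by blast+
  then show "flag {hd w} {1..n} (std_flag w)"
    using flag_full_flag[OF word_tl(1)[OF assms], of "{hd w}"] by (simp add: std_flag_def)
  show "length (std_flag w) = n - 1" using word_tl(4)[OF assms] by (simp add: std_flag_def)
qed

lemma top_cycle_eq_0:
  assumes n: "n \<ge> 1" and c: "c \<in> cycles n (n - 1)"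
    and std: "\<And>w. word n w \<Longrightarrow> c (std_chain w) = 0"
  shows "c = (\<lambda>_. 0)"
proof (rule Cgroup_eqI[OF n])
  fix w ts assume w: "word n w" and ts: "flag {hd w} {1..n} ts" "length ts = n - 1"
  note t = word_tl[OF w n]
  show "c (word_chain w ts) = 0"
  proof (rule top_cocycle_unique[OF _ t(1-3)])
    show "cocycle {hd w} {1..n} (length (tl w)) (\<lambda>ts. c (word_chain w ts))"
      using c w unfolding cycles_iff[OF n] t(4) by blast
    show "c (word_chain w (full_flag {hd w} (tl w))) = 0"
      using std[OF w] by (simp add: std_chain_def std_flag_def)
  qed (use ts t(4) in simp_all)
qed (use c in \<open>simp_all add: cycles_def Cgroup_def\<close>)

lemma top_cycle_exists:
  fixes a :: "nat list \<Rightarrow> 'k::comm_ring_1"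
  assumes n: "n \<ge> 1"
  shows "\<exists>c\<in>cycles n (n - 1). \<forall>w. word n w \<longrightarrow> c (std_chain w) = a w"
proof -
  have "\<exists>z. cocycle {hd w} {1..n} (n - 1) z \<and> z (std_flag w) = (1::'k)" if w: "word n w" for w
    using top_cocycle_exists[OF _ word_tl(1-3)[OF w n]] word_tl(4)[OF w n]
    by (simp add: std_flag_def)
  then obtain z where z: "\<And>w. word n w \<Longrightarrow> cocycle {hd w} {1..n} (n - 1) (z w)"
    "\<And>w. word n w \<Longrightarrow> z w (std_flag w) = (1::'k)" by metis
  let ?c = "of_words n (n - 1) (\<lambda>w ts. a w * z w ts)"
  have "cocycle {hd w} {1..n} (n - 1) (\<lambda>ts. ?c (word_chain w ts))" if w: "word n w" for w
    unfolding cocycle_def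
  proof (intro allI impI)
    fix ts assume ts: "flag {hd w} {1..n} ts" "Suc (length ts) = n - 1"
    have "bd {hd w} (\<lambda>us. ?c (word_chain w us)) ts = bd {hd w} (\<lambda>us. a w * z w us) ts"
      by (rule bd_cong[OF _ ts(1)]) (simp add: of_words_word_chain[OF n w] ts(2))
    also have "\<dots> = 0" using z(1)[OF w] ts by (simp add: bd_scale cocycle_def)
    finally show "bd {hd w} (\<lambda>us. ?c (word_chain w us)) ts = 0" .
  qed
  then have "?c \<in> cycles n (n - 1)" by (simp add: cycles_iff[OF n] of_words_in_Cgroup)
  moreover have "?c (std_chain w) = a w" if w: "word n w" for w
    by (simp only: std_chain_def of_words_word_chain[OF n w flag_std_flag[OF w n]] z(2)[OF w] mult_1_right)
  ultimately show ?thesis by blast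
qed

text \<open>A flag from \<open>{hd w}\<close> to [n] has at most n - 1 steps, so there is no chain
  one degree higher.\<close>

lemma boundaries_top:
  assumes n: "n \<ge> 1"
  shows "boundaries n (n - 1) = {\<lambda>_. 0::'k::comm_ring_1}"
proof -
  have "chains n (Suc (n - 1)) = {}"
  proof (rule equals0I)
    fix ch assume "ch \<in> chains n (Suc (n - 1))"
    then obtain w ts where w: "word n w" and ts: "flag {hd w} {1..n} ts" "length ts = Suc (n - 1)"
      using chains_E[OF _ n] by metis
    show False using flag_length[OF ts(1)] card_word[OF w n] ts(2) by simp
  qed
  then have "Cgroup n (Suc (n - 1)) = {\<lambda>_. 0::'k}" "bdry n (Suc (n - 1)) (\<lambda>_. 0) = (\<lambda>_. 0::'k)"
    by (auto simp: Cgroup_def bdry_def)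
  then show ?thesis by (simp add: boundaries_def)
qed

section \<open>Words as permutations, and equivariance\<close>

definition perm_word :: "nat \<Rightarrow> (nat \<Rightarrow> nat) \<Rightarrow> nat list" where
  "perm_word n \<tau> = map \<tau> [1..<Suc n]"

text \<open>The identity off \<open>{1..n}\<close>, as \<open>permutes\<close> demands.\<close>

definition word_perm :: "nat \<Rightarrow> nat list \<Rightarrow> nat \<Rightarrow> nat" where
  "word_perm n w = (\<lambda>i. if i \<in> {1..n} then w ! (i - 1) else i)"

lemma word_of_permutation: "\<tau> permutes {1..n} \<Longrightarrow> word n (perm_word n \<tau>)"
  by (auto simp: word_def perm_word_def distinct_map permutes_image permutes_inj_on
      atLeastLessThanSuc_atLeastAtMost simp del: upt_Suc)

lemma word_perm_perm_word:
  assumes "\<tau> permutes {1..n}"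
  shows "word_perm n (perm_word n \<tau>) = \<tau>"
proof
  fix i
  show "word_perm n (perm_word n \<tau>) i = \<tau> i"
    using permutes_not_in[OF assms, of i]
    by (auto simp: word_perm_def perm_word_def nth_append simp del: upt_Suc)
qed

lemma perm_word_word_perm:
  assumes "word n w"
  shows "perm_word n (word_perm n w) = w" "word_perm n w permutes {1..n}"
proof -
  have len: "length w = n" using assms distinct_card[of w] by (simp add: word_def)
  show eq: "perm_word n (word_perm n w) = w"
    by (rule nth_equalityI) (auto simp: perm_word_def word_perm_def len simp del: upt_Suc)
  have "distinct (map (word_perm n w) [1..<Suc n])" "word_perm n w ` {1..n} = {1..n}"
    using assms arg_cong[OF eq, of set] eq
    by (simp_all add: word_def perm_word_def atLeastLessThanSuc_atLeastAtMost del: upt_Suc)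
  then show "word_perm n w permutes {1..n}"
    by (intro bij_imp_permutes bij_betw_imageI)
      (auto simp: distinct_map atLeastLessThanSuc_atLeastAtMost word_perm_def simp del: upt_Suc)
qed

text \<open>Injectivity keeps the test \<open>hd w \<in> A\<close> unchanged under
  relabelling.\<close>

lemma map_map_cuts: "inj \<rho> \<Longrightarrow> map (map \<rho>) (cuts A w) = cuts (\<rho> ` A) (map \<rho> w)"
proof (induction w)
  case (Cons a w)
  have IH: "map (map \<rho>) (cuts A w) = cuts (\<rho> ` A) (map \<rho> w)" using Cons by simp
  show ?case
  proof (cases "w = [] \<or> hd w \<in> A")
    case True
    then show ?thesis using IH by (auto simp: hd_map)
  next
    case False
    then have "hd (map \<rho> w) \<notin> \<rho> ` A" using Cons.prems by (simp add: hd_map inj_image_mem_iff)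
    then show ?thesis using False by (simp flip: IH add: hd_map map_tl)
  qed
qed simp

lemma relabel_blocks: "inj \<rho> \<Longrightarrow> relabel \<rho> (blocks w A) = blocks (map \<rho> w) (\<rho> ` A)"
  by (simp add: relabel_def flip: map_map_cuts)

lemma map_full_flag: "map ((`) \<rho>) (full_flag S xs) = full_flag (\<rho> ` S) (map \<rho> xs)"
  by (induction xs arbitrary: S) auto

text \<open>The standard chain is built from the word without any choice, so it is natural in the
  letters; this is the source of equivariance.\<close>

lemma relabel_std_chain:
  assumes "inj \<rho>" "w \<noteq> []"
  shows "map (relabel \<rho>) (std_chain w) = std_chain (map \<rho> w)"
proof -
  have "full_flag {hd (map \<rho> w)} (tl (map \<rho> w)) = map ((`) \<rho>) (full_flag {hd w} (tl w))"
    using assms(2) by (simp add: map_full_flag hd_map map_tl)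
  then show ?thesis
    using assms(1) by (simp add: std_chain_def std_flag_def word_chain_def relabel_blocks)
      (simp add: relabel_def)
qed

text \<open>The boundaries vanish in this degree, so it suffices that the coefficients of a cycle at
  the standard chains determine it and can be prescribed freely.\<close>

lemma top_homology_iso:
  assumes n: "n \<ge> 1"
  shows "homology_iso_regular n (n - 1)
    (\<lambda>(c :: nat list set list \<Rightarrow> 'k::comm_ring_1) \<tau>.
       if \<tau> permutes {1..n} then c (std_chain (perm_word n \<tau>)) else 0)"
    (is "homology_iso_regular _ _ ?\<phi>")
proof -
  have equivariant: "?\<phi> (chain_act \<sigma> c) = reg_act \<sigma> (?\<phi> c)" if s: "\<sigma> permutes {1..n}"
    for \<sigma> and c :: "nat list set list \<Rightarrow> 'k"
  proof
    fix \<tau>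
    have p: "inv \<sigma> permutes {1..n}" by (rule permutes_inv[OF s])
    \<comment> \<open>Composing with \<open>\<sigma>\<close> gives back \<open>\<tau>\<close>, so
      the conditionals on the two sides take the same branch.\<close>
    have "\<tau> permutes {1..n}" if "inv \<sigma> \<circ> \<tau> permutes {1..n}"
      using permutes_compose[OF that s] permutes_surj[OF s]
      by (simp add: o_assoc permutes_inv_o(1)[OF s])
    then have iff: "inv \<sigma> \<circ> \<tau> permutes {1..n} \<longleftrightarrow> \<tau> permutes {1..n}"
      using permutes_compose[OF _ p] by blast
    have "map (relabel (inv \<sigma>)) (std_chain (perm_word n \<tau>)) = std_chain (perm_word n (inv \<sigma> \<circ> \<tau>))"
      using relabel_std_chain[OF permutes_inj[OF p], of "perm_word n \<tau>"] n
      by (simp add: perm_word_def del: upt_Suc)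
    then show "?\<phi> (chain_act \<sigma> c) \<tau> = reg_act \<sigma> (?\<phi> c) \<tau>"
      by (simp only: chain_act_def reg_act_def iff)
  qed
  have image: "?\<phi> ` cycles n (n - 1) = regrep n"
  proof
    show "?\<phi> ` cycles n (n - 1) \<subseteq> regrep n" by (auto simp: regrep_def split: if_splits)
    show "regrep n \<subseteq> ?\<phi> ` cycles n (n - 1)"
    proof
      fix f :: "(nat \<Rightarrow> nat) \<Rightarrow> 'k"
      assume f: "f \<in> regrep n"
      obtain c where c: "c \<in> cycles n (n - 1)"
        "\<And>w. word n w \<Longrightarrow> c (std_chain w) = f (word_perm n w)"
        using top_cycle_exists[OF n, of "\<lambda>w. f (word_perm n w)"] by blast
      have "f = ?\<phi> c"
      proof
        fix \<tau>
        show "f \<tau> = ?\<phi> c \<tau>"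
          using f c(2)[OF word_of_permutation] by (auto simp: regrep_def word_perm_perm_word)
      qed
      then show "f \<in> ?\<phi> ` cycles n (n - 1)" using c(1) by blast
    qed
  qed
  have "c = (\<lambda>_. 0)" if c: "c \<in> cycles n (n - 1)" "?\<phi> c = (\<lambda>_. 0)" for c
  proof (rule top_cycle_eq_0[OF n c(1)])
    fix w assume w: "word n w"
    show "c (std_chain w) = 0"
      using fun_cong[OF c(2), of "word_perm n w"] perm_word_word_perm[OF w] by simp
  qed
  moreover have "(\<lambda>_. 0) \<in> cycles n (n - 1)"
    using boundaries_subset_cycles[OF n, of "n - 1"] boundaries_top[OF n] by blast
  ultimately have kernel: "{c \<in> cycles n (n - 1). ?\<phi> c = (\<lambda>_. 0)} = boundaries n (n - 1)"
    unfolding boundaries_top[OF n] by auto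
  show ?thesis
    unfolding homology_iso_regular_def using equivariant image kernel by (auto simp: fun_eq_iff)
qed

theorem mainTheorem10:
  fixes n l :: nat
  assumes "n \<ge> 1"
    and "admissible_coeffs TYPE('k::comm_ring_1)"
  shows "(l = n - 1 \<longrightarrow>
            (\<exists>\<phi> :: (nat list set list \<Rightarrow> 'k) \<Rightarrow> ((nat \<Rightarrow> nat) \<Rightarrow> 'k).
               homology_iso_regular n l \<phi>)) \<and>
         (l \<noteq> n - 1 \<longrightarrow> cycles n l = (boundaries n l :: (nat list set list \<Rightarrow> 'k) set))"
  using top_homology_iso[OF assms(1)] cycles_eq_boundaries[OF assms(1)] by blast

end
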